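(* Let $A$ be a compact metric space without isolated points and $f:A\to A$ a continuous map such that the semicascade $(A,f)$ is minimal. Let $(X,d)$ be a locally compact metric space without isolated points and let $H$ be a topological subgroup of the homeomorphism group of $X$ (with composition as group operation), endowed with the compact-open topology. Let $\phi:A\to H$ be continuous, and let $\phi(n,a)=\phi_n(a):=\phi(f^{n-1}(a))\circ\cdots\circ\phi(a)$ for $n\ge 1$, with $\phi_0(a)=\mathrm{id}_X$, be the corresponding cocycle $\mathbb{Z}_+\times A\to H$, defining the skew product $F:A\times X\to A\times X$, $F(a,x)=(f(a),\phi(a)x)$. If there exists $a\in A$ such that the maps in $\{\phi(f^n(a)): n\in\mathbb{Z}_+\}$ commute pairwise and the sequence of maps $(\phi_n(a))_n$ on $X$ is weakly mixing, then the skew product $(A\times X,F)$ is topologically transitive.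
   Context: $\mathbb{N}$ denotes the positive integers and $\mathbb{Z}_+$ the non-negative integers. A semicascade $(Y,S)$ is a space $Y$ with a continuous self-map $S$. It is minimal if for every $y\in Y$ the orbit $\{S^n y:n\in\mathbb{Z}_+\}$ is dense in $Y$. It is topologically transitive if for all nonempty open $U,V\subset Y$ there is $n\in\mathbb{N}$ with $S^n(U)\cap V\ne\emptyset$. A sequence $(T_n)$ of continuous self-maps of $X$ is weakly mixing if for all nonempty open $U_1,U_2,V_1,V_2\subset X$ there is $n\in\mathbb{N}$ with $T_n(U_1)\cap V_1\neq\emptyset$ and $T_n(U_2)\cap V_2\neq\emptyset$. *)

theory Defs
  imports "HOL-Analysis.Analysis" "HOL-Algebra.Group"
begin

section \<open>Semicascades and sequences of maps\<close>

text \<open>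
  The three dynamical notions below are meant for continuous maps; continuity is not part of
  the predicates and is assumed or known separately.
\<close>

definition minimal :: "('y::topological_space \<Rightarrow> 'y) \<Rightarrow> bool" where
  "minimal S \<longleftrightarrow> (\<forall>y. closure (range (\<lambda>n. (S ^^ n) y)) = UNIV)"

definition topologically_transitive :: "('y::topological_space \<Rightarrow> 'y) \<Rightarrow> bool" where
  "topologically_transitive S \<longleftrightarrow>
    (\<forall>U V. open U \<and> U \<noteq> {} \<and> open V \<and> V \<noteq> {} \<longrightarrow>
      (\<exists>n\<ge>1. (S ^^ n) ` U \<inter> V \<noteq> {}))"

text \<open>The sequence is indexed by the positive integers, so \<open>T 0\<close> is irrelevant.\<close>

definition weakly_mixing :: "(nat \<Rightarrow> 'y::topological_space \<Rightarrow> 'y) \<Rightarrow> bool" where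
  "weakly_mixing T \<longleftrightarrow>
    (\<forall>U1 U2 V1 V2.
      open U1 \<and> U1 \<noteq> {} \<and> open U2 \<and> U2 \<noteq> {} \<and>
      open V1 \<and> V1 \<noteq> {} \<and> open V2 \<and> V2 \<noteq> {} \<longrightarrow>
      (\<exists>n\<ge>1. T n ` U1 \<inter> V1 \<noteq> {} \<and> T n ` U2 \<inter> V2 \<noteq> {}))"


section \<open>The homeomorphism group and the compact-open topology\<close>

definition homeo_group :: "('x::topological_space \<Rightarrow> 'x) monoid" where
  "homeo_group =
    \<lparr>carrier = {h. \<exists>k. homeomorphism UNIV UNIV h k}, mult = (\<circ>), one = id\<rparr>"

lemma group_homeo_group: "group (homeo_group :: ('x::topological_space \<Rightarrow> 'x) monoid)"
proof (rule groupI)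
  fix g h :: "'x \<Rightarrow> 'x"
  assume "g \<in> carrier homeo_group" "h \<in> carrier homeo_group"
  then obtain g' h' where "homeomorphism UNIV UNIV g g'" "homeomorphism UNIV UNIV h h'"
    by (auto simp: homeo_group_def)
  then show "g \<otimes>\<^bsub>homeo_group\<^esub> h \<in> carrier homeo_group"
    by (auto simp: homeo_group_def intro: homeomorphism_compose)
next
  show "\<one>\<^bsub>homeo_group\<^esub> \<in> carrier (homeo_group :: ('x \<Rightarrow> 'x) monoid)"
    by (auto simp: homeo_group_def id_def intro: homeomorphism_ident)
next
  fix h :: "'x \<Rightarrow> 'x"
  assume "h \<in> carrier homeo_group"
  then obtain k where "homeomorphism UNIV UNIV h k"
    by (auto simp: homeo_group_def)
  then show "\<exists>k\<in>carrier homeo_group. k \<otimes>\<^bsub>homeo_group\<^esub> h = \<one>\<^bsub>homeo_group\<^esub>"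
    by (intro bexI[of _ k])
       (auto simp: homeo_group_def homeomorphism_def fun_eq_iff intro!: exI[of _ h])
qed (auto simp: homeo_group_def)

text \<open>
  The topology on the set of all continuous maps; the choice \<open>K = {}\<close> shows that its carrier
  is that whole set. On a group \<open>H\<close> of homeomorphisms the compact-open topology is
  \<open>subtopology compact_open_topology H\<close>.
\<close>

definition compact_open_topology ::
    "('x::topological_space \<Rightarrow> 'y::topological_space) topology" where
  "compact_open_topology =
    topology_generated_by
      {{g. continuous_on UNIV g \<and> g ` K \<subseteq> U} | K U. compact K \<and> open U}"

definition topological_group :: "('g, 'm) monoid_scheme \<Rightarrow> 'g topology \<Rightarrow> bool" where
  "topological_group G T \<longleftrightarrow>
    group G \<and> topspace T = carrier G \<and>
    continuous_map (prod_topology T T) T (\<lambda>(g, h). g \<otimes>\<^bsub>G\<^esub> h) \<and>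
    continuous_map T T (\<lambda>g. inv\<^bsub>G\<^esub> g)"

text \<open>
  The compact-open topology need not make inversion continuous on the full homeomorphism group
  of a locally compact space, so being a topological group is a condition on \<open>H\<close>.
\<close>

definition topological_homeo_subgroup :: "('x::topological_space \<Rightarrow> 'x) set \<Rightarrow> bool" where
  "topological_homeo_subgroup H \<longleftrightarrow>
    subgroup H homeo_group \<and>
    topological_group (homeo_group\<lparr>carrier := H\<rparr>) (subtopology compact_open_topology H)"


section \<open>Cocycles and skew products\<close>

primrec cocycle :: "('a \<Rightarrow> 'a) \<Rightarrow> ('a \<Rightarrow> 'x \<Rightarrow> 'x) \<Rightarrow> nat \<Rightarrow> 'a \<Rightarrow> 'x \<Rightarrow> 'x" where
  "cocycle f \<phi> 0 a = id"
| "cocycle f \<phi> (Suc n) a = \<phi> ((f ^^ n) a) \<circ> cocycle f \<phi> n a"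

definition skew_product :: "('a \<Rightarrow> 'a) \<Rightarrow> ('a \<Rightarrow> 'x \<Rightarrow> 'x) \<Rightarrow> 'a \<times> 'x \<Rightarrow> 'a \<times> 'x" where
  "skew_product f \<phi> = (\<lambda>(a, x). (f a, \<phi> a x))"

end

theory Submission
  imports Defs
begin

text \<open>
  Since the maps \<open>\<phi>\<^sub>n(a)\<close> commute, Furstenberg's intersection lemma upgrades weak mixing to
  simultaneous hitting for any finite family of pairs of open sets. Given open \<open>U\<close> and \<open>V\<close>,
  minimality of \<open>f\<close> and surjectivity of the cocycle show that every fibre of \<open>A \<times> X\<close> contains a
  point that \<open>F\<close> eventually moves into \<open>V\<close>; by compactness of \<open>A\<close>, finitely many boxes \<open>B \<times> C\<close>
  that are moved into \<open>V\<close> suffice for the sets \<open>B\<close> to cover \<open>A\<close>. Pick \<open>k\<close> such that \<open>f\<^sup>k(a)\<close> lies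
  in the base of a box in \<open>U\<close>, and let \<open>W\<close> be the preimage of the side of that box under
  \<open>\<phi>\<^sub>k(a)\<close>. Some late \<open>\<phi>\<^sub>m(a)\<close> maps a point of \<open>W\<close> into each of the sets \<open>C\<close>. One of the
  boxes has \<open>f\<^sup>m(a) \<in> B\<close>, so the \<open>F\<close>-orbit of a point \<open>(a, z)\<close> with \<open>z \<in> W\<close> meets \<open>U\<close> at time
  \<open>k\<close>, then this box at time \<open>m\<close>, then \<open>V\<close>.
\<close>

section \<open>Weakly mixing sequences of commuting maps\<close>

text \<open>Pairs are merged one at a time: if \<open>T n\<close> sends \<open>x\<close> into
  \<open>U2\<close> and \<open>T m x\<close> into \<open>V2\<close>, commutation gives
  \<open>T m (T n x) \<in> V2\<close>, so a single point \<open>x\<close> witnesses a hit at time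
  \<open>m\<close> for both pairs.\<close>

lemma weakly_mixing_finite_intersection:
  fixes T :: "nat \<Rightarrow> 'y::topological_space \<Rightarrow> 'y"
  assumes wm: "weakly_mixing T"
    and cont: "\<And>n. continuous_on UNIV (T n)"
    and comm: "\<And>m n. T m \<circ> T n = T n \<circ> T m"
    and "finite P"
    and "\<And>U V. (U, V) \<in> P \<Longrightarrow> open U \<and> U \<noteq> {} \<and> open V \<and> V \<noteq> {}"
  shows "\<exists>U V. open U \<and> U \<noteq> {} \<and> open V \<and> V \<noteq> {} \<and>
    (\<forall>m. T m ` U \<inter> V \<noteq> {} \<longrightarrow> (\<forall>(U', V')\<in>P. T m ` U' \<inter> V' \<noteq> {}))"
  using assms(4,5)
proof (induction P rule: finite_induct)
  case empty
  show ?case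
    by (intro exI[of _ UNIV]) auto
next
  case (insert p P)
  obtain U1 V1 where p: "p = (U1, V1)"
    by (cases p)
  have 1: "open U1" "U1 \<noteq> {}" "open V1" "V1 \<noteq> {}"
    using insert.prems[of U1 V1] p by auto
  obtain U2 V2 where 2: "open U2" "U2 \<noteq> {}" "open V2" "V2 \<noteq> {}"
    and hit: "\<And>m. T m ` U2 \<inter> V2 \<noteq> {} \<Longrightarrow> \<forall>(U', V')\<in>P. T m ` U' \<inter> V' \<noteq> {}"
    using insert.IH insert.prems by (metis insertCI)
  \<comment> \<open>The pairing is crossed: sources go to sources and targets to targets, which
    makes both \<open>U\<close> and \<open>V\<close> nonempty.\<close>
  obtain n where n: "T n ` U1 \<inter> U2 \<noteq> {}" "T n ` V1 \<inter> V2 \<noteq> {}"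
    using wm 1 2 unfolding weakly_mixing_def by meson
  define U where "U = U1 \<inter> T n -` U2"
  define V where "V = V1 \<inter> T n -` V2"
  have "open U" "open V"
    unfolding U_def V_def using 1 2 cont[of n] by (auto intro!: open_Int open_vimage)
  moreover have "U \<noteq> {}" "V \<noteq> {}"
    using n unfolding U_def V_def by auto
  moreover have "\<forall>(U', V')\<in>insert p P. T m ` U' \<inter> V' \<noteq> {}" if "T m ` U \<inter> V \<noteq> {}" for m
  proof -
    obtain x where x: "x \<in> U1" "T n x \<in> U2" "T m x \<in> V1" "T n (T m x) \<in> V2"
      using \<open>T m ` U \<inter> V \<noteq> {}\<close> unfolding U_def V_def by auto
    have "T m (T n x) \<in> V2"
      using x(4) comm[of m n] by (metis comp_apply)
    then have "T m ` U2 \<inter> V2 \<noteq> {}" "T m ` U1 \<inter> V1 \<noteq> {}"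
      using x by auto
    then show ?thesis
      using hit p by auto
  qed
  ultimately show ?case
    by blast
qed

text \<open>A space without isolated points is infinite, so some \<open>y\<close> avoids the
  finitely many points \<open>T i x\<close> with \<open>i \<le> k\<close>; Hausdorff separation and
  finite intersections do the rest.\<close>

lemma disjoint_open_images:
  fixes T :: "nat \<Rightarrow> 'y::{perfect_space, t2_space} \<Rightarrow> 'y"
  assumes "\<And>n. continuous_on UNIV (T n)"
  shows "\<exists>U V. open U \<and> U \<noteq> {} \<and> open V \<and> V \<noteq> {} \<and> (\<forall>i\<le>k. T i ` U \<inter> V = {})"
proof -
  obtain x :: 'y where True by blast
  have "infinite (UNIV :: 'y set)"
    using islimpt_UNIV[of x] islimpt_finite by blast
  then obtain y where y: "y \<notin> (\<lambda>i. T i x) ` {..k}"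
    by (metis ex_new_if_finite finite_atMost finite_imageI)
  have "\<exists>A B. open A \<and> open B \<and> T i x \<in> A \<and> y \<in> B \<and> A \<inter> B = {}" if "i \<le> k" for i
    using y that by (intro hausdorff) auto
  then obtain A B where AB: "\<And>i. i \<le> k \<Longrightarrow>
      open (A i) \<and> open (B i) \<and> T i x \<in> A i \<and> y \<in> B i \<and> A i \<inter> B i = {}"
    by metis
  define U where "U = (\<Inter>i\<le>k. T i -` A i)"
  define V where "V = (\<Inter>i\<le>k. B i)"
  have "open U" "open V"
    unfolding U_def V_def using AB assms by (auto intro!: open_INT open_vimage)
  moreover have "x \<in> U" "y \<in> V"
    unfolding U_def V_def using AB by auto
  moreover have "T i ` U \<inter> V = {}" if "i \<le> k" for i
    using AB[OF that] that unfolding U_def V_def by auto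
  ultimately show ?thesis
    by blast
qed

section \<open>Cocycles and skew products\<close>

lemma skew_product_funpow:
  "(skew_product f \<phi> ^^ n) (a, x) = ((f ^^ n) a, cocycle f \<phi> n a x)"
proof (induction n)
  case (Suc n)
  then show ?case
    by (simp add: skew_product_def)
qed simp

lemma cocycle_continuous_on:
  assumes "\<And>b. continuous_on UNIV (\<phi> b)"
  shows "continuous_on UNIV (cocycle f \<phi> n a)"
proof (induction n)
  case (Suc n)
  then show ?case
    by (auto simp: o_def intro: continuous_on_compose2[OF assms])
qed (simp add: id_def)

lemma cocycle_surj:
  assumes "\<And>b. surj (\<phi> b)"
  shows "surj (cocycle f \<phi> n a)"
proof (induction n)
  case (Suc n)
  then show ?case
    using comp_surj[OF Suc.IH assms] by simp
qed simp

lemma cocycle_commute: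
  assumes "pairwise (\<lambda>g h. g \<circ> h = h \<circ> g) (range (\<lambda>n. \<phi> ((f ^^ n) a)))"
  shows "cocycle f \<phi> m a \<circ> cocycle f \<phi> n a = cocycle f \<phi> n a \<circ> cocycle f \<phi> m a"
proof -
  \<comment> \<open>\<open>pairwise\<close> constrains distinct maps; equal ones commute
    trivially.\<close>
  have gen: "\<phi> ((f ^^ i) a) \<circ> \<phi> ((f ^^ j) a) = \<phi> ((f ^^ j) a) \<circ> \<phi> ((f ^^ i) a)" for i j
    using assms unfolding pairwise_def by (cases "\<phi> ((f ^^ i) a) = \<phi> ((f ^^ j) a)") auto
  have *: "\<phi> ((f ^^ i) a) \<circ> cocycle f \<phi> n a = cocycle f \<phi> n a \<circ> \<phi> ((f ^^ i) a)" for i n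
  proof (induction n)
    case (Suc n)
    have "\<phi> ((f ^^ i) a) \<circ> cocycle f \<phi> (Suc n) a =
        (\<phi> ((f ^^ i) a) \<circ> \<phi> ((f ^^ n) a)) \<circ> cocycle f \<phi> n a"
      by (simp only: cocycle.simps comp_assoc)
    also have "\<dots> = \<phi> ((f ^^ n) a) \<circ> (\<phi> ((f ^^ i) a) \<circ> cocycle f \<phi> n a)"
      by (simp only: gen[of i n] comp_assoc)
    also have "\<dots> = cocycle f \<phi> (Suc n) a \<circ> \<phi> ((f ^^ i) a)"
      by (simp only: Suc.IH cocycle.simps comp_assoc)
    finally show ?case .
  qed simp
  show ?thesis
  proof (induction m)
    case (Suc m)
    have "cocycle f \<phi> (Suc m) a \<circ> cocycle f \<phi> n a =
        \<phi> ((f ^^ m) a) \<circ> (cocycle f \<phi> m a \<circ> cocycle f \<phi> n a)"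
      by (simp only: cocycle.simps comp_assoc)
    also have "\<dots> = (\<phi> ((f ^^ m) a) \<circ> cocycle f \<phi> n a) \<circ> cocycle f \<phi> m a"
      by (simp only: Suc.IH comp_assoc)
    also have "\<dots> = cocycle f \<phi> n a \<circ> cocycle f \<phi> (Suc m) a"
      by (simp only: * cocycle.simps comp_assoc)
    finally show ?case .
  qed simp
qed

lemma compact_open_subbasic:
  assumes "compact K" "open W"
  shows "openin compact_open_topology {g. continuous_on UNIV g \<and> g ` K \<subseteq> W}"
  unfolding compact_open_topology_def
proof (rule topology_generated_by_Basis, rule CollectI)
  show "\<exists>K' W'. {g. continuous_on UNIV g \<and> g ` K \<subseteq> W} =
      {g. continuous_on UNIV g \<and> g ` K' \<subseteq> W'} \<and> compact K' \<and> open W'"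
    using assms by (intro exI[of _ K] exI[of _ W]) simp
qed

lemma skew_product_continuous_on:
  fixes f :: "'a::topological_space \<Rightarrow> 'a" and \<phi> :: "'a \<Rightarrow> 'x::metric_space \<Rightarrow> 'x"
  assumes lc: "locally_compact_space (euclidean :: 'x topology)"
    and f: "continuous_on UNIV f"
    and \<phi>: "continuous_map euclidean compact_open_topology \<phi>"
    and cont: "\<And>b. continuous_on UNIV (\<phi> b)"
  shows "continuous_on UNIV (skew_product f \<phi>)"
proof -
  have nb: "neighbourhood_base_of (compactin euclidean) (euclidean :: 'x topology)"
    using lc locally_compact_space_neighbourhood_base Hausdorff_space_euclidean by blast
  have "continuous_on UNIV (\<lambda>p. \<phi> (fst p) (snd p))"
    unfolding continuous_on_open_vimage[OF open_UNIV]
  proof (intro allI impI, subst open_subopen, rule ballI)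
    fix W :: "'x set" and p :: "'a \<times> 'x"
    assume W: "open W" and p: "p \<in> (\<lambda>p. \<phi> (fst p) (snd p)) -` W \<inter> UNIV"
    obtain b x where bx: "p = (b, x)"
      by (cases p)
    have "open (\<phi> b -` W)" "x \<in> \<phi> b -` W"
      using W cont[of b] p bx by (auto intro: open_vimage)
    then obtain N K where NK: "open N" "compact K" "x \<in> N" "N \<subseteq> K" "K \<subseteq> \<phi> b -` W"
      using nb unfolding neighbourhood_base_of open_openin[symmetric] compactin_euclidean_iff
      by meson
    define B where "B = {c. \<phi> c ` K \<subseteq> W}"
    have "open B"
      using openin_continuous_map_preimage[OF \<phi> compact_open_subbasic[OF NK(2) W]] cont
      by (simp add: B_def)
    moreover have "b \<in> B"
      using NK(5) by (auto simp: B_def)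
    moreover have "\<phi> c y \<in> W" if "c \<in> B" "y \<in> N" for c y
      using that NK(4) by (auto simp: B_def)
    ultimately show "\<exists>S. open S \<and> p \<in> S \<and> S \<subseteq> (\<lambda>p. \<phi> (fst p) (snd p)) -` W \<inter> UNIV"
      using NK(1,3) bx by (intro exI[of _ "B \<times> N"]) (auto intro!: open_Times)
  qed
  then show ?thesis
    unfolding skew_product_def case_prod_unfold
    by (intro continuous_intros continuous_on_compose2[OF f]) auto
qed

section \<open>Minimality of the base and transitivity of the skew product\<close>

lemma minimal_visits:
  assumes "minimal f" "open U" "U \<noteq> {}"
  obtains n where "(f ^^ n) b \<in> U"
proof -
  have "closure (range (\<lambda>n. (f ^^ n) b)) \<inter> U \<noteq> {}"
    using assms unfolding minimal_def by auto
  then have "range (\<lambda>n. (f ^^ n) b) \<inter> U \<noteq> {}"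
    using open_Int_closure_eq_empty[OF assms(2)] by (metis Int_commute)
  then show thesis
    using that by auto
qed

lemma open_contains_box:
  assumes "open W" "p \<in> W"
  obtains B C where "open B" "open C" "fst p \<in> B" "snd p \<in> C" "B \<times> C \<subseteq> W"
proof (rule open_prod_elim[OF assms])
  fix B C
  assume "open B" "open C" "p \<in> B \<times> C" "B \<times> C \<subseteq> W"
  then show thesis
    by (intro that[of B C]) (simp_all add: mem_Times_iff)
qed

text \<open>The dynamical core: \<open>H\<close> and its topology enter through continuity of the
  skew product and through continuity and surjectivity of the fibre maps.\<close>

lemma skew_product_transitive:
  fixes f :: "'a::topological_space \<Rightarrow> 'a" and \<phi> :: "'a \<Rightarrow> 'x::{perfect_space, t2_space} \<Rightarrow> 'x"
  assumes "compact (UNIV :: 'a set)"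
    and "minimal f"
    and contF: "continuous_on UNIV (skew_product f \<phi>)"
    and cont\<phi>: "\<And>b. continuous_on UNIV (\<phi> b)"
    and surj\<phi>: "\<And>b. surj (\<phi> b)"
    and comm: "pairwise (\<lambda>g h. g \<circ> h = h \<circ> g) (range (\<lambda>n. \<phi> ((f ^^ n) a)))"
    and wm: "weakly_mixing (\<lambda>n. cocycle f \<phi> n a)"
  shows "topologically_transitive (skew_product f \<phi>)"
  unfolding topologically_transitive_def
proof (intro allI impI, elim conjE)
  fix U V :: "('a \<times> 'x) set"
  assume UV: "open U" "U \<noteq> {}" "open V" "V \<noteq> {}"
  define F where "F = skew_product f \<phi>"
  define T where "T = (\<lambda>n. cocycle f \<phi> n a)"
  have F: "(F ^^ n) (b, x) = ((f ^^ n) b, cocycle f \<phi> n b x)" for n b x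
    unfolding F_def by (rule skew_product_funpow)
  have contT: "continuous_on UNIV (T n)" for n
    unfolding T_def using cont\<phi> by (rule cocycle_continuous_on)
  have contFn: "continuous_on UNIV (F ^^ n)" for n
  proof (induction n)
    case (Suc n)
    then show ?case
      unfolding F_def by (auto simp: o_def intro: continuous_on_compose2[OF contF])
  qed (simp add: id_def)

  define \<B> where "\<B> = {B. open B \<and> (\<exists>C i. open C \<and> C \<noteq> {} \<and> B \<times> C \<subseteq> (F ^^ i) -` V)}"
  have "b \<in> \<Union>\<B>" for b
  proof -
    \<comment> \<open>Minimality steers the base coordinate near \<open>fst v\<close>; surjectivity
      then allows a choice of \<open>x\<close> whose fibre coordinate at that time is exactly
      \<open>snd v\<close>.\<close>
    obtain v where "v \<in> V"
      using UV by blast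
    then obtain V1 V2 where V: "open V1" "open V2" "fst v \<in> V1" "snd v \<in> V2" "V1 \<times> V2 \<subseteq> V"
      using open_contains_box[OF UV(3)] by metis
    obtain i where i: "(f ^^ i) b \<in> V1"
      using minimal_visits[OF \<open>minimal f\<close> V(1)] V(3) by blast
    have "surj (cocycle f \<phi> i b)"
      using surj\<phi> by (rule cocycle_surj)
    then obtain x where x: "cocycle f \<phi> i b x = snd v"
      by (metis surjD)
    have "(F ^^ i) (b, x) \<in> V1 \<times> V2"
      using V(4) i x by (simp add: F)
    then have "(b, x) \<in> (F ^^ i) -` V"
      using V(5) by blast
    then obtain B C where "open B" "open C" "b \<in> B" "x \<in> C" "B \<times> C \<subseteq> (F ^^ i) -` V"
      using open_contains_box[OF open_vimage[OF UV(3) contFn], of "(b, x)" i]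
      unfolding fst_conv snd_conv by blast
    then have "B \<in> \<B>" "b \<in> B"
      unfolding \<B>_def by blast+
    then show ?thesis
      by blast
  qed
  then have "UNIV \<subseteq> \<Union>\<B>"
    by blast
  moreover have "open B" if "B \<in> \<B>" for B
    using that unfolding \<B>_def by simp
  ultimately obtain \<B>' where \<B>': "\<B>' \<subseteq> \<B>" "finite \<B>'" "UNIV \<subseteq> \<Union>\<B>'"
    using compactE[OF \<open>compact UNIV\<close>] by metis
  have "\<forall>B\<in>\<B>'. \<exists>C i. open C \<and> C \<noteq> {} \<and> B \<times> C \<subseteq> (F ^^ i) -` V"
  proof
    fix B
    assume "B \<in> \<B>'"
    then have "B \<in> \<B>"
      using \<B>'(1) by blast
    then show "\<exists>C i. open C \<and> C \<noteq> {} \<and> B \<times> C \<subseteq> (F ^^ i) -` V"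
      unfolding \<B>_def by simp
  qed
  then obtain C i where C:
    "\<And>B. B \<in> \<B>' \<Longrightarrow> open (C B) \<and> C B \<noteq> {} \<and> B \<times> C B \<subseteq> (F ^^ i B) -` V"
    by metis

  obtain u where "u \<in> U"
    using UV by blast
  then obtain U1 U2 where U: "open U1" "open U2" "fst u \<in> U1" "snd u \<in> U2" "U1 \<times> U2 \<subseteq> U"
    using open_contains_box[OF UV(1)] by metis
  obtain k where k: "(f ^^ k) a \<in> U1"
    using minimal_visits[OF \<open>minimal f\<close> U(1)] U(3) by blast
  define W where "W = T k -` U2"
  have "surj (T k)"
    unfolding T_def using surj\<phi> by (rule cocycle_surj)
  then obtain w where "T k w = snd u"
    by (metis surjD)
  then have W: "open W" "W \<noteq> {}"
    using U contT unfolding W_def by (auto intro: open_vimage)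

  \<comment> \<open>The extra pair \<open>(U0, V0)\<close> forces the common hitting time to exceed \<open>k\<close>.\<close>
  obtain U0 V0 where 0: "open U0" "U0 \<noteq> {}" "open V0" "V0 \<noteq> {}"
      "\<And>j. j \<le> k \<Longrightarrow> T j ` U0 \<inter> V0 = {}"
    using disjoint_open_images[of T k] contT by blast
  define P where "P = insert (U0, V0) ((\<lambda>B. (W, C B)) ` \<B>')"
  have "finite P"
    unfolding P_def using \<B>' by simp
  moreover have "open G \<and> G \<noteq> {} \<and> open G' \<and> G' \<noteq> {}" if "(G, G') \<in> P" for G G'
    using that 0 W C unfolding P_def by auto
  ultimately obtain G G' where G: "open G" "G \<noteq> {}" "open G'" "G' \<noteq> {}"
    and hit: "\<And>m. T m ` G \<inter> G' \<noteq> {} \<Longrightarrow> \<forall>(U', V')\<in>P. T m ` U' \<inter> V' \<noteq> {}"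
    using weakly_mixing_finite_intersection[of T P] wm contT cocycle_commute[OF comm]
    unfolding T_def by metis
  \<comment> \<open>Here weak mixing suffices with the pair \<open>(G, G')\<close> taken
    twice.\<close>
  then obtain m where m: "T m ` G \<inter> G' \<noteq> {}"
    using wm unfolding weakly_mixing_def T_def by meson
  have "T m ` U0 \<inter> V0 \<noteq> {}"
    using hit[OF m] unfolding P_def by auto
  then have "m > k"
    using 0(5) by (meson not_le)
  \<comment> \<open>The box depends on \<open>m\<close>, which is why \<open>m\<close> had to serve
    all sets \<open>C B\<close> at once.\<close>
  obtain B where B: "B \<in> \<B>'" "(f ^^ m) a \<in> B"
    using \<B>'(3) by blast
  have "T m ` W \<inter> C B \<noteq> {}"
    using hit[OF m] B(1) unfolding P_def by auto
  then obtain z where z: "z \<in> W" "T m z \<in> C B"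
    by blast
  have "(F ^^ m) (a, z) \<in> B \<times> C B"
    using B z by (simp add: F T_def)
  moreover have "B \<times> C B \<subseteq> (F ^^ i B) -` V"
    using C[OF B(1)] by simp
  ultimately have "(F ^^ i B) ((F ^^ m) (a, z)) \<in> V"
    by (rule vimageD[OF subsetD, rotated])
  \<comment> \<open>As \<open>m > k\<close>, the natural subtraction is exact and the remaining time
    is at least 1 even when \<open>i B = 0\<close>.\<close>
  moreover have "F ^^ i B \<circ> F ^^ m = F ^^ (i B + m - k) \<circ> F ^^ k"
    using \<open>m > k\<close> by (simp flip: funpow_add)
  then have "(F ^^ i B) ((F ^^ m) (a, z)) = (F ^^ (i B + m - k)) ((F ^^ k) (a, z))"
    by (rule comp_eq_dest)
  moreover have "(F ^^ k) (a, z) \<in> U"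
    using k z U(5) unfolding W_def T_def by (auto simp: F)
  ultimately show "\<exists>n\<ge>1. (skew_product f \<phi> ^^ n) ` U \<inter> V \<noteq> {}"
    using \<open>m > k\<close> unfolding F_def[symmetric]
    by (intro exI[of _ "i B + m - k"]) auto
qed

theorem theorem3p9:
  fixes f :: "'a::{metric_space, perfect_space} \<Rightarrow> 'a"
    and H :: "('x::{metric_space, perfect_space} \<Rightarrow> 'x) set"
    and \<phi> :: "'a \<Rightarrow> 'x \<Rightarrow> 'x"
  assumes "compact (UNIV :: 'a set)"
    and "continuous_on UNIV f"
    and "minimal f"
    and "locally_compact_space (euclidean :: 'x topology)"
    and "topological_homeo_subgroup H"
    and "continuous_map euclidean (subtopology compact_open_topology H) \<phi>"
    and "\<exists>a. pairwise (\<lambda>g h. g \<circ> h = h \<circ> g) (range (\<lambda>n. \<phi> ((f ^^ n) a))) \<and>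
             weakly_mixing (\<lambda>n. cocycle f \<phi> n a)"
  shows "topologically_transitive (skew_product f \<phi>)"
proof -
  have \<phi>: "continuous_map euclidean compact_open_topology \<phi>" "\<phi> b \<in> H" for b
    using assms(6) by (auto simp: continuous_map_in_subtopology)
  have "H \<subseteq> carrier homeo_group"
    using assms(5) unfolding topological_homeo_subgroup_def by (blast dest: subgroup.subset)
  then have homeo: "\<exists>k. homeomorphism UNIV UNIV (\<phi> b) k" for b
    using \<phi>(2)[of b] unfolding homeo_group_def by auto
  have cont: "continuous_on UNIV (\<phi> b)" and surj: "surj (\<phi> b)" for b
    using homeo[of b] unfolding homeomorphism_def by auto
  show ?thesis
    using assms(7) skew_product_transitive[OF assms(1,3), where \<phi> = \<phi>]
      skew_product_continuous_on[OF assms(4,2) \<phi>(1) cont] cont surj by blast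
qed

end
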